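(* Let $T=(T,\rho)$ be a compact metric space, $N(u)$ the metric massiveness of $(T,\rho)$, and $X=\{X(t),t\in T\}$ a separable random process from the space $\mathbf F_\psi^*(\Omega)$ with norm $\|\cdot\|$. Let $\varkappa(n)$ be a majorizing characteristic of $\mathbf F_\psi^*(\Omega)$ and let $\varkappa(u)$, $u\ge1$, be any monotonically increasing function coinciding with $\varkappa(n)$ for integers $n\ge1$. Suppose there is a continuous, monotonically increasing function $\sigma=\{\sigma(h),\,0\le h\le\sup_{t,s\in T}\rho(t,s)\}$ with $\sigma(0)=0$ and $$\sup_{\rho(t,s)\le h}\|X(t)-X(s)\|\le\sigma(h).$$ If for any $z>0$ $$\int_0^z\varkappa\big(N(\sigma^{(-1)}(u))\big)\,du<\infty,$$ where $\sigma^{(-1)}$ is the inverse function of $\sigma$, then with probability one the random variable $\sup_{t\in T}|X(t)|$ belongs to $\mathbf F_\psi^*(\Omega)$, and for every $0<p<1$ $$\Big\|\sup_{t\in T}|X(t)|\Big\|\le B(p),\qquad B(p)=\inf_{t\in T}\|X(t)\|+\frac1{p(1-p)}\int_0^{\gamma p}\varkappa\big(N(\sigma^{(-1)}(u))\big)\,du,$$ where $\gamma=\sigma\big(\sup_{t,s\in T}\rho(t,s)\big)$.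
   Context: Let $\psi(u)>0$, $u\ge1$, be a monotonically increasing continuous function with $\psi(u)\to\infty$ as $u\to\infty$. $\mathbf F_\psi(\Omega)$ is the Banach space of random variables with $\|\xi\|_\psi=\sup_{u\ge1}\frac{(E|\xi|^u)^{1/u}}{\psi(u)}<\infty$. It is denoted $\check{\mathbf F}_\psi(\Omega)$ if $\sup_{u\ge1}\psi(u+v)/\psi(u)<\infty$ for any $v>0$. For an increasing sequence $S_k\ge1$, $S_k\to\infty$, $\mathbf F_{S_k,\psi,r}(\Omega)$ is the Banach space of random variables with $\|\xi\|_{S_k,\psi,r}=\sup_{k\ge r}\frac{(E|\xi|^{S_k})^{1/S_k}}{\psi(S_k)}<\infty$. $\mathbf F_\psi^*(\Omega)$ denotes one of the spaces $\mathbf F_\psi(\Omega)$, $\check{\mathbf F}_\psi(\Omega)$, $\mathbf F_{S_k,\psi,r}(\Omega)$, and $\|\cdot\|$ its norm. A process belongs to $\mathbf F_\psi^*(\Omega)$ if each $X(t)$ does. A majorizing characteristic of the space is a non-decreasing numerical sequence $(\varkappa(n),n\ge1)$ such that $\|\max_{1\le i\le n}|\xi_i|\|\le\varkappa(n)\max_{1\le i\le n}\|\xi_i\|$ for all $\xi_1,\dots,\xi_n$ in the space. The metric massiveness $N(u)$ of $(T,\rho)$ is the smallest number of closed balls of radius at most $u$ that cover $T$. For $u$ exceeding $\sigma(\sup_{t,s}\rho(t,s))$, $N(\sigma^{(-1)}(u))$ is understood as $1$. *)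

theory Defs
  imports "HOL-Probability.Probability"
begin

definition psi_function :: "(real \<Rightarrow> real) \<Rightarrow> bool" where
  "psi_function \<psi> \<longleftrightarrow>
     (\<forall>u\<ge>1. \<psi> u > 0) \<and> mono_on {1..} \<psi> \<and> continuous_on {1..} \<psi> \<and> filterlim \<psi> at_top at_top"

definition Lu_norm :: "'w measure \<Rightarrow> real \<Rightarrow> ('w \<Rightarrow> real) \<Rightarrow> real" where
  "Lu_norm M u \<xi> = (\<integral>\<omega>. \<bar>\<xi> \<omega>\<bar> powr u \<partial>M) powr (1 / u)"

text \<open>
  The three kinds of spaces that the starred symbol may denote. The second kind has the same
  elements and norm as the first; it differs only in the extra condition on \<open>\<psi>\<close>.
\<close>

datatype moment_space =
    F_psi "real \<Rightarrow> real"
  | F_psi_check "real \<Rightarrow> real"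
  | F_S_psi "nat \<Rightarrow> real" "real \<Rightarrow> real" nat

fun is_moment_space :: "moment_space \<Rightarrow> bool" where
  "is_moment_space (F_psi \<psi>) \<longleftrightarrow> psi_function \<psi>"
| "is_moment_space (F_psi_check \<psi>) \<longleftrightarrow>
     psi_function \<psi> \<and> (\<forall>v>0. bdd_above ((\<lambda>u. \<psi> (u + v) / \<psi> u) ` {1..}))"
| "is_moment_space (F_S_psi S \<psi> r) \<longleftrightarrow>
     psi_function \<psi> \<and> mono S \<and> (\<forall>k. S k \<ge> 1) \<and> filterlim S at_top sequentially"

fun moment_norm :: "'w measure \<Rightarrow> moment_space \<Rightarrow> ('w \<Rightarrow> real) \<Rightarrow> real" where
  "moment_norm M (F_psi \<psi>) \<xi> = (SUP u\<in>{1..}. Lu_norm M u \<xi> / \<psi> u)"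
| "moment_norm M (F_psi_check \<psi>) \<xi> = (SUP u\<in>{1..}. Lu_norm M u \<xi> / \<psi> u)"
| "moment_norm M (F_S_psi S \<psi> r) \<xi> = (SUP k\<in>{r..}. Lu_norm M (S k) \<xi> / \<psi> (S k))"

text \<open>
  The real-valued supremum and Bochner integral above are meaningful only on the carrier below,
  which spells out that the norm is finite: all the moments exist, and the quotients are bounded.
  The elements are representatives; almost surely equal ones are not identified.
\<close>

fun moment_carrier :: "'w measure \<Rightarrow> moment_space \<Rightarrow> ('w \<Rightarrow> real) set" where
  "moment_carrier M (F_psi \<psi>) =
     {\<xi> \<in> borel_measurable M.
        (\<forall>u\<ge>1. integrable M (\<lambda>\<omega>. \<bar>\<xi> \<omega>\<bar> powr u)) \<and>
        bdd_above ((\<lambda>u. Lu_norm M u \<xi> / \<psi> u) ` {1..})}"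
| "moment_carrier M (F_psi_check \<psi>) =
     {\<xi> \<in> borel_measurable M.
        (\<forall>u\<ge>1. integrable M (\<lambda>\<omega>. \<bar>\<xi> \<omega>\<bar> powr u)) \<and>
        bdd_above ((\<lambda>u. Lu_norm M u \<xi> / \<psi> u) ` {1..})}"
| "moment_carrier M (F_S_psi S \<psi> r) =
     {\<xi> \<in> borel_measurable M.
        (\<forall>k\<ge>r. integrable M (\<lambda>\<omega>. \<bar>\<xi> \<omega>\<bar> powr S k)) \<and>
        bdd_above ((\<lambda>k. Lu_norm M (S k) \<xi> / \<psi> (S k)) ` {r..})}"

definition majorizing_characteristic ::
    "'w measure \<Rightarrow> moment_space \<Rightarrow> (nat \<Rightarrow> real) \<Rightarrow> bool" where
  "majorizing_characteristic M F \<kappa> \<longleftrightarrow>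
     mono_on {1..} \<kappa> \<and>
     (\<forall>n\<ge>1. \<forall>\<xi> :: nat \<Rightarrow> 'w \<Rightarrow> real. (\<forall>i\<in>{1..n}. \<xi> i \<in> moment_carrier M F) \<longrightarrow>
        moment_norm M F (\<lambda>\<omega>. MAX i\<in>{1..n}. \<bar>\<xi> i \<omega>\<bar>)
          \<le> \<kappa> n * (MAX i\<in>{1..n}. moment_norm M F (\<xi> i)))"

text \<open>Balls are those of the metric space \<open>T\<close>, so their centres lie in \<open>T\<close>.\<close>

definition metric_massiveness :: "'a::metric_space set \<Rightarrow> real \<Rightarrow> nat" where
  "metric_massiveness T u =
     (LEAST n. \<exists>\<B>. finite \<B> \<and> card \<B> = n \<and>
        (\<forall>B\<in>\<B>. \<exists>c\<in>T. \<exists>r. 0 \<le> r \<and> r \<le> u \<and> B = cball c r \<inter> T) \<and> T \<subseteq> \<Union>\<B>)"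

text \<open>
  The composition of the massiveness with the inverse of \<open>\<sigma>\<close>, which is defined on
  \<open>[0, diameter T]\<close>, extended by 1 beyond the range of \<open>\<sigma>\<close>.
\<close>

definition massiveness_inv :: "'a::metric_space set \<Rightarrow> (real \<Rightarrow> real) \<Rightarrow> real \<Rightarrow> nat" where
  "massiveness_inv T \<sigma> u =
     (if u > \<sigma> (diameter T) then 1
      else metric_massiveness T (inv_into {0..diameter T} \<sigma> u))"

text \<open>
  Separability in the sense of Doob: outside a single null event, for every relatively open
  \<open>G\<close> and closed \<open>C\<close>, membership of the values in \<open>C\<close> over \<open>G\<close> is decided on \<open>G \<inter> D\<close>.
\<close>

definition separable_process ::
    "'w measure \<Rightarrow> 'a::metric_space set \<Rightarrow> ('a \<Rightarrow> 'w \<Rightarrow> real) \<Rightarrow> bool" where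
  "separable_process M T X \<longleftrightarrow>
     (\<forall>t\<in>T. X t \<in> borel_measurable M) \<and>
     (\<exists>D N. countable D \<and> D \<subseteq> T \<and> T \<subseteq> closure D \<and> N \<in> null_sets M \<and>
        (\<forall>G C. openin (top_of_set T) G \<longrightarrow> closed C \<longrightarrow>
           (\<forall>\<omega>\<in>space M - N.
              (\<forall>t\<in>G \<inter> D. X t \<omega> \<in> C) \<longleftrightarrow> (\<forall>t\<in>G. X t \<omega> \<in> C))))"

end

theory Submission
  imports Defs
begin

text \<open>
  The proof is Dudley's chaining argument, with the usual maximal inequality replaced by the
  majorizing characteristic. Let \<open>\<gamma> = \<sigma> d\<close> for the diameter \<open>d\<close> of \<open>T\<close>, and for each \<open>k\<close> take a minimal net
  whose radius is the inverse image under \<open>\<sigma>\<close> of \<open>\<gamma> p\<^sup>k\<close>. The net at level \<open>0\<close> can be any single point.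
  Each point of level \<open>k + 1\<close> has a neighbour at level \<open>k\<close> such that the increment between them has norm
  at most \<open>\<gamma> p\<^sup>k\<close>, so the norm of the maximum over the nets grows at this step by at most \<open>\<gamma> p\<^sup>k\<close>
  times the characteristic at the cardinality of the finer net (\<open>moment_bounded_Max_step\<close>). Since
  massiveness decreases with the radius, the sum of these costs is a lower Riemann sum, along a
  geometric partition, for the entropy integral over \<open>(0, \<gamma> p]\<close>, up to the factor \<open>p (1 - p)\<close>
  (\<open>geometric_sum_le_integral\<close>).
  
  The bound is transferred to any finite subset of \<open>T\<close> by linking it to a very fine net, with an
  error that tends to \<open>0\<close> (\<open>moment_norm_finite_Max_le\<close>). Finite subsets of a countable separant
  increase to the separant, and monotone convergence keeps the bound on every moment
  (\<open>moment_bounded_SUP\<close>); in particular the supremum is almost surely finite. Separability finally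
  identifies this supremum with the supremum over \<open>T\<close> outside a null set. Applying the bound directly
  to finite subsets of the separant avoids comparing the separant with the union of the nets.
  
  Behind this lies the fact that the moment spaces are normed spaces whose balls are closed under
  domination and increasing limits; the triangle inequality is Minkowski's inequality for each
  exponent (\<open>nn_integral_powr_add_le\<close>).
\<close>

section \<open>Moment spaces as weighted families of moments\<close>

text \<open>
  All three kinds of spaces have the same shape: a nonempty set of exponents \<open>u \<ge> 1\<close> and a positive
  weight \<open>\<psi> u\<close>, the norm being the supremum of the weighted \<open>L\<^sup>u\<close> norms over these exponents. The two
  functions below extract these data, so that every later argument is carried out once.
\<close>

fun exponents :: "moment_space \<Rightarrow> real set" where
  "exponents (F_psi \<psi>) = {1..}"
| "exponents (F_psi_check \<psi>) = {1..}"
| "exponents (F_S_psi S \<psi> r) = S ` {r..}"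

fun weight :: "moment_space \<Rightarrow> real \<Rightarrow> real" where
  "weight (F_psi \<psi>) = \<psi>"
| "weight (F_psi_check \<psi>) = \<psi>"
| "weight (F_S_psi S \<psi> r) = \<psi>"

lemma exponents_nonempty: "exponents F \<noteq> {}"
  by (cases F) auto

lemma exponents_ge_1: "is_moment_space F \<Longrightarrow> u \<in> exponents F \<Longrightarrow> u \<ge> 1"
  by (cases F) auto

lemma weight_pos: "is_moment_space F \<Longrightarrow> u \<in> exponents F \<Longrightarrow> weight F u > 0"
  using exponents_ge_1[of F u] by (cases F) (auto simp: psi_function_def)

text \<open>
  The lower bound \<open>\<psi> 1\<close> on the weights makes the constants members of the space.
\<close>

lemma weight_ge_weight_1:
  "is_moment_space F \<Longrightarrow> u \<in> exponents F \<Longrightarrow> 0 < weight F 1 \<and> weight F 1 \<le> weight F u"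
  using exponents_ge_1[of F u]
  by (cases F) (auto simp: psi_function_def mono_on_def)

lemma moment_norm_eq_SUP: "moment_norm M F \<xi> = (SUP u\<in>exponents F. Lu_norm M u \<xi> / weight F u)"
  by (cases F) (auto simp: image_image)

lemma moment_carrier_iff:
  "\<xi> \<in> moment_carrier M F \<longleftrightarrow>
     \<xi> \<in> borel_measurable M \<and>
     (\<forall>u\<in>exponents F. integrable M (\<lambda>\<omega>. \<bar>\<xi> \<omega>\<bar> powr u)) \<and>
     bdd_above ((\<lambda>u. Lu_norm M u \<xi> / weight F u) ` exponents F)"
  by (cases F) (auto simp: image_image)

lemma moment_carrier_measurable: "\<xi> \<in> moment_carrier M F \<Longrightarrow> \<xi> \<in> borel_measurable M"
  by (simp add: moment_carrier_iff)

text \<open>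
  For \<open>C \<ge> 0\<close> this is membership in the ball of radius \<open>C\<close>. It is phrased with nonnegative integrals
  because the inequality then includes the existence of the moments, and because domination and
  monotone convergence apply to it without any integrability side condition.
\<close>

definition moment_bounded :: "'w measure \<Rightarrow> moment_space \<Rightarrow> real \<Rightarrow> ('w \<Rightarrow> real) \<Rightarrow> bool" where
  "moment_bounded M F C \<xi> \<longleftrightarrow> \<xi> \<in> borel_measurable M \<and>
     (\<forall>u\<in>exponents F. (\<integral>\<^sup>+\<omega>. ennreal (\<bar>\<xi> \<omega>\<bar> powr u) \<partial>M) \<le> ennreal ((C * weight F u) powr u))"

lemma nn_integral_powr_le_iff:
  fixes \<xi> :: "'w \<Rightarrow> real"
  assumes [measurable]: "\<xi> \<in> borel_measurable M" and u: "u \<ge> 1" and c: "c \<ge> 0"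
  shows "(\<integral>\<^sup>+\<omega>. ennreal (\<bar>\<xi> \<omega>\<bar> powr u) \<partial>M) \<le> ennreal (c powr u) \<longleftrightarrow>
         integrable M (\<lambda>\<omega>. \<bar>\<xi> \<omega>\<bar> powr u) \<and> Lu_norm M u \<xi> \<le> c"
proof -
  define I where "I = (\<integral>\<omega>. \<bar>\<xi> \<omega>\<bar> powr u \<partial>M)"
  have I0: "I \<ge> 0" unfolding I_def by simp
  have root: "I powr (1 / u) \<le> c \<longleftrightarrow> I \<le> c powr u"
  proof
    assume "I powr (1 / u) \<le> c"
    then have "(I powr (1 / u)) powr u \<le> c powr u" using u by (intro powr_mono2) auto
    then show "I \<le> c powr u" using u I0 by (simp add: powr_powr)
  next
    assume "I \<le> c powr u"
    then have "I powr (1 / u) \<le> (c powr u) powr (1 / u)" using u I0 by (intro powr_mono2) auto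
    then show "I powr (1 / u) \<le> c" using u c by (simp add: powr_powr)
  qed
  have eq: "(\<integral>\<^sup>+\<omega>. ennreal (\<bar>\<xi> \<omega>\<bar> powr u) \<partial>M) = ennreal I"
    if "integrable M (\<lambda>\<omega>. \<bar>\<xi> \<omega>\<bar> powr u)"
    unfolding I_def using that by (intro nn_integral_eq_integral) auto
  have "integrable M (\<lambda>\<omega>. \<bar>\<xi> \<omega>\<bar> powr u)"
    if "(\<integral>\<^sup>+\<omega>. ennreal (\<bar>\<xi> \<omega>\<bar> powr u) \<partial>M) \<le> ennreal (c powr u)"
    using that by (intro integrableI_nonneg) (auto simp: less_top[symmetric] top_unique)
  then show ?thesis
    using eq root by (auto simp: Lu_norm_def I_def[symmetric] ennreal_le_iff)
qed

lemma moment_bounded_iff: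
  assumes F: "is_moment_space F" and C: "C \<ge> 0"
  shows "moment_bounded M F C \<xi> \<longleftrightarrow> \<xi> \<in> moment_carrier M F \<and> moment_norm M F \<xi> \<le> C"
proof -
  have "(\<integral>\<^sup>+\<omega>. ennreal (\<bar>\<xi> \<omega>\<bar> powr u) \<partial>M) \<le> ennreal ((C * weight F u) powr u) \<longleftrightarrow>
      integrable M (\<lambda>\<omega>. \<bar>\<xi> \<omega>\<bar> powr u) \<and> Lu_norm M u \<xi> / weight F u \<le> C"
    if "\<xi> \<in> borel_measurable M" and u: "u \<in> exponents F" for u
    using nn_integral_powr_le_iff[OF that(1) exponents_ge_1[OF F u], of "C * weight F u"]
      weight_pos[OF F u] C by (simp add: pos_divide_le_eq)
  then have *: "moment_bounded M F C \<xi> \<longleftrightarrow> \<xi> \<in> borel_measurable M \<and>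
     (\<forall>u\<in>exponents F. integrable M (\<lambda>\<omega>. \<bar>\<xi> \<omega>\<bar> powr u) \<and> Lu_norm M u \<xi> / weight F u \<le> C)"
    unfolding moment_bounded_def by (simp cong: conj_cong ball_cong)
  let ?q = "\<lambda>u. Lu_norm M u \<xi> / weight F u"
  have "(\<forall>u\<in>exponents F. ?q u \<le> C) \<longleftrightarrow> bdd_above (?q ` exponents F) \<and> (SUP u\<in>exponents F. ?q u) \<le> C"
    (is "?L \<longleftrightarrow> ?R")
  proof
    assume ?L
    then show ?R using exponents_nonempty[of F] by (auto intro!: cSUP_least bdd_aboveI2)
  next
    assume ?R
    then show ?L by (meson cSUP_upper order_trans)
  qed
  then show ?thesis
    by (simp add: * moment_carrier_iff moment_norm_eq_SUP ball_conj_distrib conj_assoc)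
qed

lemma moment_norm_nonneg:
  assumes F: "is_moment_space F" and \<xi>: "\<xi> \<in> moment_carrier M F"
  shows "0 \<le> moment_norm M F \<xi>"
proof -
  obtain u where u: "u \<in> exponents F" using exponents_nonempty by blast
  have "0 \<le> Lu_norm M u \<xi> / weight F u"
    using weight_pos[OF F u] by (simp add: Lu_norm_def)
  also have "\<dots> \<le> moment_norm M F \<xi>"
    unfolding moment_norm_eq_SUP using \<xi> u by (intro cSUP_upper) (auto simp: moment_carrier_iff)
  finally show ?thesis .
qed

lemma moment_bounded_moment_norm:
  "is_moment_space F \<Longrightarrow> \<xi> \<in> moment_carrier M F \<Longrightarrow> moment_norm M F \<xi> \<le> C \<Longrightarrow> moment_bounded M F C \<xi>"
  using moment_bounded_iff[of F C M \<xi>] moment_norm_nonneg[of F \<xi> M] by auto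

lemma moment_boundedD:
  assumes "is_moment_space F" "C \<ge> 0" "moment_bounded M F C \<xi>"
  shows "\<xi> \<in> moment_carrier M F" and "moment_norm M F \<xi> \<le> C"
  using moment_bounded_iff[of F C M \<xi>] assms by auto

lemma moment_bounded_dominated:
  assumes F: "is_moment_space F" and \<eta>: "moment_bounded M F C \<eta>" and [measurable]: "\<xi> \<in> borel_measurable M"
    and le: "\<And>\<omega>. \<omega> \<in> space M \<Longrightarrow> \<bar>\<xi> \<omega>\<bar> \<le> \<bar>\<eta> \<omega>\<bar>"
  shows "moment_bounded M F C \<xi>"
  unfolding moment_bounded_def
proof (intro conjI ballI)
  fix u assume u: "u \<in> exponents F"
  have "(\<integral>\<^sup>+\<omega>. ennreal (\<bar>\<xi> \<omega>\<bar> powr u) \<partial>M) \<le> (\<integral>\<^sup>+\<omega>. ennreal (\<bar>\<eta> \<omega>\<bar> powr u) \<partial>M)"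
    using le exponents_ge_1[OF F u] by (intro nn_integral_mono ennreal_leI powr_mono2) auto
  also have "\<dots> \<le> ennreal ((C * weight F u) powr u)"
    using \<eta> u by (simp add: moment_bounded_def)
  finally show "(\<integral>\<^sup>+\<omega>. ennreal (\<bar>\<xi> \<omega>\<bar> powr u) \<partial>M) \<le> ennreal ((C * weight F u) powr u)" .
qed fact

section \<open>The triangle inequality\<close>

text \<open>
  Convexity of \<open>powr\<close> on the closed half-line. At an endpoint \<open>0\<close> it reduces to \<open>k powr u \<le> k\<close> for
  \<open>0 \<le> k \<le> 1\<close>.
\<close>

lemma powr_convex_nonneg:
  fixes x y l m u :: real
  assumes u: "u \<ge> 1" and "x \<ge> 0" "y \<ge> 0" "l \<ge> 0" "m \<ge> 0" "l + m = 1"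
  shows "(l * x + m * y) powr u \<le> l * x powr u + m * y powr u"
proof -
  have scale: "(k * z) powr u \<le> k * z powr u" if "0 \<le> k" "k \<le> 1" "z \<ge> 0" for k z :: real
  proof -
    have "k powr u \<le> k"
      using powr_mono'[of 1 u k] that u by (cases "k = 0") auto
    then show ?thesis using that by (simp add: powr_mult mult_right_mono)
  qed
  consider "x = 0" | "y = 0" | "x > 0" "y > 0" using assms by linarith
  then show ?thesis
  proof cases
    case 1 then show ?thesis using scale[of m y] assms by simp
  next
    case 2 then show ?thesis using scale[of l x] assms by simp
  next
    case 3 then show ?thesis
      using powr_convex[OF u] assms unfolding convex_on_def by auto
  qed
qed

text \<open>
  Minkowski's inequality for radii \<open>a\<close> and \<open>b\<close>: write \<open>\<bar>f\<bar> + \<bar>g\<bar>\<close> as \<open>a + b\<close> times the convex combination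
  of \<open>\<bar>f\<bar> / a\<close> and \<open>\<bar>g\<bar> / b\<close> with coefficients \<open>a / (a + b)\<close> and \<open>b / (a + b)\<close>, apply convexity
  pointwise, and integrate; each normalised function contributes at most its coefficient.
\<close>

lemma nn_integral_powr_add_le:
  fixes f g :: "'w \<Rightarrow> real"
  assumes [measurable]: "f \<in> borel_measurable M" "g \<in> borel_measurable M"
    and u: "u \<ge> 1" and a: "a > 0" and b: "b > 0"
    and f: "(\<integral>\<^sup>+\<omega>. ennreal (\<bar>f \<omega>\<bar> powr u) \<partial>M) \<le> ennreal (a powr u)"
    and g: "(\<integral>\<^sup>+\<omega>. ennreal (\<bar>g \<omega>\<bar> powr u) \<partial>M) \<le> ennreal (b powr u)"
  shows "(\<integral>\<^sup>+\<omega>. ennreal (\<bar>f \<omega> + g \<omega>\<bar> powr u) \<partial>M) \<le> ennreal ((a + b) powr u)"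
proof -
  define l where "l = a / (a + b)"
  define m where "m = b / (a + b)"
  have lm: "l \<ge> 0" "m \<ge> 0" "l + m = 1"
    using a b by (auto simp: l_def m_def add_divide_distrib[symmetric])
  define \<alpha> where "\<alpha> = (a + b) powr u * l / a powr u"
  define \<beta> where "\<beta> = (a + b) powr u * m / b powr u"
  have nn: "\<alpha> \<ge> 0" "\<beta> \<ge> 0" using lm by (auto simp: \<alpha>_def \<beta>_def)
  have pt: "\<bar>f \<omega> + g \<omega>\<bar> powr u \<le> \<alpha> * \<bar>f \<omega>\<bar> powr u + \<beta> * \<bar>g \<omega>\<bar> powr u" for \<omega>
  proof -
    have "\<bar>f \<omega> + g \<omega>\<bar> powr u \<le> ((a + b) * (l * (\<bar>f \<omega>\<bar> / a) + m * (\<bar>g \<omega>\<bar> / b))) powr u"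
      using u a b abs_triangle_ineq[of "f \<omega>" "g \<omega>"]
      by (intro powr_mono2) (auto simp: l_def m_def distrib_left)
    also have "\<dots> = (a + b) powr u * (l * (\<bar>f \<omega>\<bar> / a) + m * (\<bar>g \<omega>\<bar> / b)) powr u"
      using a b lm by (intro powr_mult)
    also have "\<dots> \<le> (a + b) powr u * (l * (\<bar>f \<omega>\<bar> / a) powr u + m * (\<bar>g \<omega>\<bar> / b) powr u)"
      using a b lm u by (intro mult_left_mono powr_convex_nonneg) auto
    also have "\<dots> = \<alpha> * \<bar>f \<omega>\<bar> powr u + \<beta> * \<bar>g \<omega>\<bar> powr u"
      using a b by (simp add: \<alpha>_def \<beta>_def powr_divide distrib_left)
    finally show ?thesis .
  qed
  have "(\<integral>\<^sup>+\<omega>. ennreal (\<bar>f \<omega> + g \<omega>\<bar> powr u) \<partial>M)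
      \<le> (\<integral>\<^sup>+\<omega>. ennreal \<alpha> * ennreal (\<bar>f \<omega>\<bar> powr u) + ennreal \<beta> * ennreal (\<bar>g \<omega>\<bar> powr u) \<partial>M)"
    using pt nn by (intro nn_integral_mono) (simp add: ennreal_mult[symmetric] ennreal_plus[symmetric] del: ennreal_plus)
  also have "\<dots> = ennreal \<alpha> * (\<integral>\<^sup>+\<omega>. ennreal (\<bar>f \<omega>\<bar> powr u) \<partial>M)
      + ennreal \<beta> * (\<integral>\<^sup>+\<omega>. ennreal (\<bar>g \<omega>\<bar> powr u) \<partial>M)"
    by (subst nn_integral_add) (auto simp: nn_integral_cmult)
  also have "\<dots> \<le> ennreal \<alpha> * ennreal (a powr u) + ennreal \<beta> * ennreal (b powr u)"
    by (intro add_mono mult_left_mono f g) auto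
  also have "\<dots> = ennreal (\<alpha> * a powr u + \<beta> * b powr u)"
    using nn by (simp add: ennreal_mult)
  also have "\<alpha> * a powr u + \<beta> * b powr u = (a + b) powr u * (l + m)"
    using a b by (simp add: \<alpha>_def \<beta>_def distrib_left)
  finally show ?thesis using lm by simp
qed

text \<open>
  The normalisation in Minkowski's inequality requires positive radii, so both radii are enlarged
  by \<open>e / 2\<close> and \<open>e\<close> tends to \<open>0\<close> at the end.
\<close>

lemma moment_bounded_add:
  assumes F: "is_moment_space F" and C: "C \<ge> 0" and D: "D \<ge> 0"
    and f: "moment_bounded M F C f" and g: "moment_bounded M F D g"
  shows "moment_bounded M F (C + D) (\<lambda>\<omega>. f \<omega> + g \<omega>)"
proof -
  have meas [measurable]: "f \<in> borel_measurable M" "g \<in> borel_measurable M"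
    using f g by (auto simp: moment_bounded_def)
  have *: "moment_bounded M F (C + D + e) (\<lambda>\<omega>. f \<omega> + g \<omega>)" if e: "e > 0" for e
    unfolding moment_bounded_def
  proof (intro conjI ballI)
    fix u assume u: "u \<in> exponents F"
    have w: "weight F u > 0" by (rule weight_pos[OF F u])
    have mono: "(c * weight F u) powr u \<le> ((c + e / 2) * weight F u) powr u" if "c \<ge> 0" for c
      using that e w exponents_ge_1[OF F u] by (intro powr_mono2 mult_right_mono) auto
    have "(\<integral>\<^sup>+\<omega>. ennreal (\<bar>f \<omega> + g \<omega>\<bar> powr u) \<partial>M)
       \<le> ennreal (((C + e / 2) * weight F u + (D + e / 2) * weight F u) powr u)"
    proof (rule nn_integral_powr_add_le)
      show "(\<integral>\<^sup>+\<omega>. ennreal (\<bar>f \<omega>\<bar> powr u) \<partial>M) \<le> ennreal (((C + e / 2) * weight F u) powr u)"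
        by (rule order_trans[OF _ ennreal_leI[OF mono[OF C]]]) (use f u in \<open>simp add: moment_bounded_def\<close>)
      show "(\<integral>\<^sup>+\<omega>. ennreal (\<bar>g \<omega>\<bar> powr u) \<partial>M) \<le> ennreal (((D + e / 2) * weight F u) powr u)"
        by (rule order_trans[OF _ ennreal_leI[OF mono[OF D]]]) (use g u in \<open>simp add: moment_bounded_def\<close>)
    qed (use C D e w exponents_ge_1[OF F u] in auto)
    then show "(\<integral>\<^sup>+\<omega>. ennreal (\<bar>f \<omega> + g \<omega>\<bar> powr u) \<partial>M) \<le> ennreal (((C + D + e) * weight F u) powr u)"
      by (simp add: algebra_simps)
  qed measurable
  have nonneg: "C + D + e \<ge> 0" if "e > 0" for e using that C D by simp
  have "moment_norm M F (\<lambda>\<omega>. f \<omega> + g \<omega>) \<le> C + D"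
    by (rule field_le_epsilon) (rule moment_boundedD(2)[OF F nonneg *])
  then show ?thesis
    by (rule moment_bounded_moment_norm[OF F moment_boundedD(1)[OF F nonneg[of 1] *[of 1]], rotated 2]) simp_all
qed

lemma moment_bounded_abs: "moment_bounded M F C (\<lambda>\<omega>. \<bar>\<xi> \<omega>\<bar>)" if "moment_bounded M F C \<xi>"
  using that by (auto simp: moment_bounded_def)

lemma moment_carrier_diff:
  assumes F: "is_moment_space F" and "f \<in> moment_carrier M F" "g \<in> moment_carrier M F"
  shows "(\<lambda>\<omega>. f \<omega> - g \<omega>) \<in> moment_carrier M F"
proof -
  let ?C = "moment_norm M F f" and ?D = "moment_norm M F g"
  have nn: "?C \<ge> 0" "?D \<ge> 0" using assms moment_norm_nonneg[OF F] by auto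
  have f: "moment_bounded M F ?C f" and "moment_bounded M F ?D g"
    using assms by (auto intro: moment_bounded_moment_norm[OF F])
  then have "moment_bounded M F ?D (\<lambda>\<omega>. - g \<omega>)" by (auto simp: moment_bounded_def)
  from moment_bounded_add[OF F nn f this] show ?thesis
    using moment_boundedD(1)[OF F add_nonneg_nonneg[OF nn]] by simp
qed

section \<open>Finite maxima and increasing limits\<close>

text \<open>
  The defining inequality of a majorizing characteristic bounds the norm of a maximum, a real number
  that says something about the moments only for elements of the space. This lemma supplies that
  membership, since a maximum of absolute values is dominated by their sum.
\<close>

lemma moment_carrier_Max:
  assumes F: "is_moment_space F" and A: "finite A" "A \<noteq> {}"
    and f: "\<And>a. a \<in> A \<Longrightarrow> f a \<in> moment_carrier M F"
  shows "(\<lambda>\<omega>. MAX a\<in>A. \<bar>f a \<omega>\<bar>) \<in> moment_carrier M F"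
  using A f
proof (induction rule: finite_ne_induct)
  case (singleton a)
  then have a: "f a \<in> moment_carrier M F" by simp
  have "(\<lambda>\<omega>. \<bar>f a \<omega>\<bar>) \<in> moment_carrier M F"
    by (rule moment_boundedD(1)[OF F moment_norm_nonneg[OF F a]])
       (rule moment_bounded_abs[OF moment_bounded_moment_norm[OF F a order_refl]])
  then show ?case by simp
next
  case (insert a A)
  let ?g = "\<lambda>\<omega>. MAX a\<in>A. \<bar>f a \<omega>\<bar>"
  let ?C = "moment_norm M F (f a)" and ?D = "moment_norm M F ?g"
  have car: "f a \<in> moment_carrier M F" "?g \<in> moment_carrier M F" using insert by auto
  then have nn: "?C \<ge> 0" "?D \<ge> 0" using moment_norm_nonneg[OF F] by auto
  have sum: "moment_bounded M F (?C + ?D) (\<lambda>\<omega>. \<bar>f a \<omega>\<bar> + ?g \<omega>)"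
    using car nn by (intro moment_bounded_add[OF F] moment_bounded_abs moment_bounded_moment_norm[OF F] order_refl)
  have g0: "?g \<omega> \<ge> 0" for \<omega>
  proof -
    obtain b where "b \<in> A" using insert.hyps by blast
    then show ?thesis
      using insert.hyps(1) by (intro order_trans[OF abs_ge_zero[of "f b \<omega>"] Max_ge]) auto
  qed
  have Max_insert_eq: "(MAX b\<in>insert a A. \<bar>f b \<omega>\<bar>) = max \<bar>f a \<omega>\<bar> (?g \<omega>)" for \<omega>
    using insert.hyps by simp
  have "(\<lambda>\<omega>. max \<bar>f a \<omega>\<bar> (?g \<omega>)) \<in> borel_measurable M"
    using car[THEN moment_carrier_measurable] by (intro borel_measurable_max borel_measurable_abs)
  then have "moment_bounded M F (?C + ?D) (\<lambda>\<omega>. max \<bar>f a \<omega>\<bar> (?g \<omega>))"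
    by (rule moment_bounded_dominated[OF F sum]) (simp add: g0)
  then show ?case
    unfolding Max_insert_eq by (rule moment_boundedD(1)[OF F add_nonneg_nonneg[OF nn]])
qed

text \<open>
  Test the characteristic on the constant function \<open>1\<close>, whose norm is positive and finite.
\<close>

lemma majorizing_characteristic_ge_1:
  assumes P: "prob_space M" and F: "is_moment_space F" and \<kappa>: "majorizing_characteristic M F \<kappa>" and n: "n \<ge> 1"
  shows "\<kappa> n \<ge> 1"
proof -
  interpret prob_space M by fact
  let ?one = "\<lambda>_. 1 :: real"
  have Lu: "Lu_norm M u ?one = 1" for u by (simp add: Lu_norm_def prob_space)
  have bdd: "bdd_above ((\<lambda>u. 1 / weight F u) ` exponents F)"
    using weight_ge_weight_1[OF F] by (intro bdd_aboveI2[of _ _ "1 / weight F 1"] frac_le) auto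
  then have car: "?one \<in> moment_carrier M F"
    by (simp add: moment_carrier_iff Lu)
  obtain u where u: "u \<in> exponents F" using exponents_nonempty by blast
  have "0 < 1 / weight F u" using weight_pos[OF F u] by simp
  also have "\<dots> \<le> moment_norm M F ?one"
    unfolding moment_norm_eq_SUP Lu using bdd u by (intro cSUP_upper) auto
  finally have pos: "moment_norm M F ?one > 0" .
  have "\<forall>\<xi> :: nat \<Rightarrow> 'a \<Rightarrow> real. (\<forall>i\<in>{1..1}. \<xi> i \<in> moment_carrier M F) \<longrightarrow>
        moment_norm M F (\<lambda>\<omega>. MAX i\<in>{1..1}. \<bar>\<xi> i \<omega>\<bar>) \<le> \<kappa> 1 * (MAX i\<in>{1..1}. moment_norm M F (\<xi> i))"
    using \<kappa> unfolding majorizing_characteristic_def by blast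
  from this[rule_format, of "\<lambda>_. ?one"] car have "moment_norm M F ?one \<le> \<kappa> 1 * moment_norm M F ?one"
    by simp
  then have "1 \<le> \<kappa> 1" using pos by simp
  also have "\<kappa> 1 \<le> \<kappa> n" using \<kappa> n by (auto simp: majorizing_characteristic_def mono_on_def)
  finally show ?thesis .
qed

text \<open>
  The characteristic for families indexed by an arbitrary finite set. The bound is
  in terms of an upper bound \<open>n\<close> of the cardinality because a net supplied by a minimal cover may have
  fewer points than the cover has balls.
\<close>

lemma moment_bounded_Max:
  assumes P: "prob_space M" and F: "is_moment_space F" and \<kappa>: "majorizing_characteristic M F \<kappa>"
    and A: "finite A" "A \<noteq> {}" and card: "card A \<le> n"
    and f: "\<And>a. a \<in> A \<Longrightarrow> f a \<in> moment_carrier M F"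
    and le: "\<And>a. a \<in> A \<Longrightarrow> moment_norm M F (f a) \<le> c"
  shows "moment_bounded M F (\<kappa> n * c) (\<lambda>\<omega>. MAX a\<in>A. \<bar>f a \<omega>\<bar>)"
proof -
  define m where "m = card A"
  have m: "1 \<le> m" "m \<le> n" using A card by (auto simp: m_def Suc_le_eq card_gt_0_iff)
  obtain h where h: "bij_betw h {1..m} A" using ex_bij_betw_nat_finite_1[OF A(1)] m_def by auto
  then have im: "h ` {1..m} = A" by (simp add: bij_betw_def)
  have c: "0 \<le> c"
    using A f le moment_norm_nonneg[OF F] by (meson all_not_in_conv order_trans)
  have reindex: "(\<lambda>i. g (h i)) ` {1..m} = g ` A" for g :: "_ \<Rightarrow> real" using im by auto
  have "\<And>\<xi> :: nat \<Rightarrow> _ \<Rightarrow> real. \<forall>i\<in>{1..m}. \<xi> i \<in> moment_carrier M F \<Longrightarrow>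
        moment_norm M F (\<lambda>\<omega>. MAX i\<in>{1..m}. \<bar>\<xi> i \<omega>\<bar>) \<le> \<kappa> m * (MAX i\<in>{1..m}. moment_norm M F (\<xi> i))"
    using \<kappa> m(1) unfolding majorizing_characteristic_def by blast
  from this[of "\<lambda>i. f (h i)"] have "moment_norm M F (\<lambda>\<omega>. MAX i\<in>{1..m}. \<bar>f (h i) \<omega>\<bar>)
      \<le> \<kappa> m * (MAX i\<in>{1..m}. moment_norm M F (f (h i)))"
    using f im by blast
  then have "moment_norm M F (\<lambda>\<omega>. MAX a\<in>A. \<bar>f a \<omega>\<bar>) \<le> \<kappa> m * (MAX a\<in>A. moment_norm M F (f a))"
    by (simp only: reindex[of "\<lambda>a. moment_norm M F (f a)"] reindex[of "\<lambda>a. \<bar>f a \<omega>\<bar>" for \<omega>])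
  also have "\<dots> \<le> \<kappa> n * c"
  proof (rule mult_mono)
    show "\<kappa> m \<le> \<kappa> n" using \<kappa> m by (auto simp: majorizing_characteristic_def mono_on_def)
    show "(MAX a\<in>A. moment_norm M F (f a)) \<le> c" using A le by simp
    show "0 \<le> (MAX a\<in>A. moment_norm M F (f a))"
      using A f moment_norm_nonneg[OF F] by (auto simp: Max_ge_iff ex_in_conv)
    show "0 \<le> \<kappa> n" using majorizing_characteristic_ge_1[OF P F \<kappa>, of n] m by simp
  qed
  finally show ?thesis
    using moment_carrier_Max[OF F A f] by (intro moment_bounded_moment_norm[OF F])
qed

text \<open>
  Balls of a moment space are closed under increasing limits: by monotone convergence each moment of
  the limit obeys the bound. The finiteness of a single moment already forces the limit to be finite
  almost surely, so that passing to a real-valued representative changes only a null set.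
\<close>

lemma moment_bounded_SUP:
  fixes \<xi> :: "nat \<Rightarrow> 'w \<Rightarrow> real"
  assumes F: "is_moment_space F"
    and b: "\<And>n. moment_bounded M F C (\<xi> n)"
    and inc: "\<And>\<omega>. incseq (\<lambda>n. \<xi> n \<omega>)" and nn: "\<And>n \<omega>. \<xi> n \<omega> \<ge> 0"
  defines "Y \<equiv> \<lambda>\<omega>. real_of_ereal (SUP n. ereal (\<xi> n \<omega>))"
  shows "moment_bounded M F C Y" and "AE \<omega> in M. (SUP n. ereal (\<xi> n \<omega>)) = ereal (Y \<omega>)"
proof -
  have [measurable]: "\<xi> n \<in> borel_measurable M" for n using b by (simp add: moment_bounded_def)
  have Ym [measurable]: "Y \<in> borel_measurable M" unfolding Y_def by measurable
  have mono: "incseq (\<lambda>n \<omega>. ennreal (\<xi> n \<omega> powr u))" if "u \<in> exponents F" for u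
    using exponents_ge_1[OF F that] inc nn
    by (auto simp: incseq_def le_fun_def intro!: ennreal_leI powr_mono2)
  have lim: "(\<integral>\<^sup>+\<omega>. (SUP n. ennreal (\<xi> n \<omega> powr u)) \<partial>M) \<le> ennreal ((C * weight F u) powr u)"
    if u: "u \<in> exponents F" for u
  proof -
    have "(\<integral>\<^sup>+\<omega>. (SUP n. ennreal (\<xi> n \<omega> powr u)) \<partial>M) = (SUP n. \<integral>\<^sup>+\<omega>. ennreal (\<xi> n \<omega> powr u) \<partial>M)"
      using mono[OF u] by (intro nn_integral_monotone_convergence_SUP) auto
    also have "\<dots> \<le> ennreal ((C * weight F u) powr u)"
      using b u nn by (intro SUP_least) (auto simp: moment_bounded_def)
    finally show ?thesis .
  qed
  have Y: "ereal (\<xi> n \<omega>) \<le> (SUP n. ereal (\<xi> n \<omega>))" for n \<omega> by (rule SUP_upper) simp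
  have fin: "(SUP n. ereal (\<xi> n \<omega>)) = ereal (Y \<omega>)" if "(SUP n. ereal (\<xi> n \<omega>)) \<noteq> \<infinity>" for \<omega>
    using that Y[of 0 \<omega>] unfolding Y_def by (cases "SUP n. ereal (\<xi> n \<omega>)") auto
  have Y0: "Y \<omega> \<ge> 0" for \<omega>
    unfolding Y_def using Y[of 0 \<omega>] nn[of 0 \<omega>] by (intro real_of_ereal_pos) (meson order_trans ereal_less_eq(5))
  obtain v where v: "v \<in> exponents F" using exponents_nonempty by blast
  have "AE \<omega> in M. (SUP n. ennreal (\<xi> n \<omega> powr v)) \<noteq> \<infinity>"
    using lim[OF v] by (intro nn_integral_noteq_infinite) (auto simp: top_unique)
  then show ae: "AE \<omega> in M. (SUP n. ereal (\<xi> n \<omega>)) = ereal (Y \<omega>)"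
  proof eventually_elim
    case (elim \<omega>)
    \<comment> \<open>Where the moment of order v is finite, its root bounds the whole sequence.\<close>
    define K where "K = enn2real (SUP n. ennreal (\<xi> n \<omega> powr v))"
    have v1: "v \<ge> 1" by (rule exponents_ge_1[OF F v])
    have "\<xi> n \<omega> \<le> K powr (1 / v)" for n
    proof -
      have "ennreal (\<xi> n \<omega> powr v) \<le> (SUP n. ennreal (\<xi> n \<omega> powr v))" by (rule SUP_upper) simp
      also have "\<dots> = ennreal K"
        using elim unfolding K_def ennreal_enn2real_if by (simp only: infinity_ennreal_def if_False)
      finally have "\<xi> n \<omega> powr v \<le> K" by (simp add: K_def ennreal_le_iff del: SUP_upper)
      then have "(\<xi> n \<omega> powr v) powr (1 / v) \<le> K powr (1 / v)" using v1 by (intro powr_mono2) auto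
      then show ?thesis using v1 nn by (simp add: powr_powr)
    qed
    then have "(SUP n. ereal (\<xi> n \<omega>)) \<le> ereal (K powr (1 / v))" by (intro SUP_least) auto
    then show ?case by (intro fin) auto
  qed
  show "moment_bounded M F C Y"
    unfolding moment_bounded_def
  proof (intro conjI ballI Ym)
    fix u assume u: "u \<in> exponents F"
    have u1: "u \<ge> 1" by (rule exponents_ge_1[OF F u])
    have "(\<integral>\<^sup>+\<omega>. ennreal (\<bar>Y \<omega>\<bar> powr u) \<partial>M) \<le> (\<integral>\<^sup>+\<omega>. (SUP n. ennreal (\<xi> n \<omega> powr u)) \<partial>M)"
    proof (rule nn_integral_mono_AE, use ae in eventually_elim)
      case (elim \<omega>)
      have "(\<lambda>n. ereal (\<xi> n \<omega>)) \<longlonglongrightarrow> (SUP n. ereal (\<xi> n \<omega>))"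
        using inc[of \<omega>] by (intro LIMSEQ_SUP) (simp add: incseq_def)
      then have "(\<lambda>n. \<xi> n \<omega>) \<longlonglongrightarrow> Y \<omega>" by (simp add: elim)
      then have "(\<lambda>n. \<xi> n \<omega> powr u) \<longlonglongrightarrow> Y \<omega> powr u"
        using u1 nn by (intro tendsto_powr2) auto
      then have "(\<lambda>n. ennreal (\<xi> n \<omega> powr u)) \<longlonglongrightarrow> ennreal (Y \<omega> powr u)"
        by (intro tendsto_ennrealI)
      moreover have "(\<lambda>n. ennreal (\<xi> n \<omega> powr u)) \<longlonglongrightarrow> (SUP n. ennreal (\<xi> n \<omega> powr u))"
        using mono[OF u] by (intro LIMSEQ_SUP) (simp add: incseq_def le_fun_def)
      ultimately have "ennreal (Y \<omega> powr u) = (SUP n. ennreal (\<xi> n \<omega> powr u))"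
        by (rule LIMSEQ_unique)
      then show ?case using Y0[of \<omega>] by (simp only: abs_of_nonneg order_refl)
    qed
    also have "\<dots> \<le> ennreal ((C * weight F u) powr u)" by (rule lim[OF u])
    finally show "(\<integral>\<^sup>+\<omega>. ennreal (\<bar>Y \<omega>\<bar> powr u) \<partial>M) \<le> ennreal ((C * weight F u) powr u)" .
  qed
qed

section \<open>Metric massiveness and the scale of increments\<close>

text \<open>
  Compactness makes the set of admissible cardinalities nonempty, so the least one is attained.
\<close>

lemma massiveness_cover:
  assumes T: "compact T" and u: "u > 0"
  shows "\<exists>\<B>. finite \<B> \<and> card \<B> = metric_massiveness T u \<and>
        (\<forall>B\<in>\<B>. \<exists>c\<in>T. \<exists>r. 0 \<le> r \<and> r \<le> u \<and> B = cball c r \<inter> T) \<and> T \<subseteq> \<Union>\<B>"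
proof -
  obtain K where K: "finite K" "K \<subseteq> T" "T \<subseteq> (\<Union>x\<in>K. ball x u)"
  proof (rule compactE_image[OF T, of T "\<lambda>x. ball x u"])
    show "T \<subseteq> (\<Union>x\<in>T. ball x u)" using u by auto
  qed auto
  define \<B> where "\<B> = (\<lambda>c. cball c u \<inter> T) ` K"
  have u0: "0 \<le> u" using u by simp
  have "finite \<B>" using K(1) by (simp add: \<B>_def)
  moreover have "\<exists>c\<in>T. \<exists>r. 0 \<le> r \<and> r \<le> u \<and> B = cball c r \<inter> T" if B: "B \<in> \<B>" for B
  proof -
    obtain c where "c \<in> K" "B = cball c u \<inter> T" using B by (auto simp: \<B>_def)
    then show ?thesis using u0 K(2) by blast
  qed
  moreover have "T \<subseteq> \<Union>\<B>"
  proof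
    fix t assume t: "t \<in> T"
    then obtain c where "c \<in> K" "t \<in> ball c u" using K(3) by blast
    then have "t \<in> cball c u \<inter> T" "cball c u \<inter> T \<in> \<B>" using t by (auto simp: \<B>_def)
    then show "t \<in> \<Union>\<B>" by blast
  qed
  ultimately have "\<exists>\<C>. finite \<C> \<and> card \<C> = card \<B> \<and>
        (\<forall>B\<in>\<C>. \<exists>c\<in>T. \<exists>r. 0 \<le> r \<and> r \<le> u \<and> B = cball c r \<inter> T) \<and> T \<subseteq> \<Union>\<C>"
    by (intro exI[of _ \<B>] conjI ballI) auto
  then show ?thesis
    unfolding metric_massiveness_def by (rule LeastI)
qed

text \<open>
  The centres of a minimal cover form a net inside \<open>T\<close>.
\<close>

lemma massiveness_net:
  fixes T :: "'a::metric_space set"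
  assumes T: "compact T" "T \<noteq> {}" and u: "u > 0"
  shows "\<exists>V\<subseteq>T. finite V \<and> V \<noteq> {} \<and> card V \<le> metric_massiveness T u \<and> (\<forall>t\<in>T. \<exists>v\<in>V. dist t v \<le> u)"
proof -
  obtain \<B> where \<B>: "finite \<B>" "card \<B> = metric_massiveness T u"
      "\<forall>B\<in>\<B>. \<exists>c\<in>T. \<exists>r. 0 \<le> r \<and> r \<le> u \<and> B = cball c r \<inter> T" "T \<subseteq> \<Union>\<B>"
    using massiveness_cover[OF T(1) u] by blast
  then obtain c where c: "\<And>B. B \<in> \<B> \<Longrightarrow> c B \<in> T \<and> (\<exists>r. 0 \<le> r \<and> r \<le> u \<and> B = cball (c B) r \<inter> T)"
    by metis
  show ?thesis
  proof (intro exI[of _ "c ` \<B>"] conjI ballI)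
    show "card (c ` \<B>) \<le> metric_massiveness T u" using card_image_le[OF \<B>(1), of c] \<B>(2) by simp
    show "\<exists>v\<in>c ` \<B>. dist t v \<le> u" if t: "t \<in> T" for t
    proof -
      obtain B where B: "B \<in> \<B>" "t \<in> B" using t \<B>(4) by blast
      with c[OF B(1)] obtain r where "r \<le> u" "t \<in> cball (c B) r" by blast
      then have "dist t (c B) \<le> u" by (simp add: dist_commute)
      with B show ?thesis by blast
    qed
  qed (use \<B>(1,4) c T in auto)
qed

lemma massiveness_ge_1:
  assumes "compact T" "T \<noteq> {}" "u > 0"
  shows "1 \<le> metric_massiveness T u"
proof -
  obtain V where V: "V \<subseteq> T" "finite V" "V \<noteq> {}" "card V \<le> metric_massiveness T u"
    using massiveness_net[OF assms] by blast
  then have "card V > 0" by (simp add: card_gt_0_iff)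
  with V(4) show ?thesis by simp
qed

text \<open>
  A cover by balls of radius at most \<open>u\<close> is also one by balls of radius at most \<open>v\<close>.
\<close>

lemma massiveness_antimono:
  assumes T: "compact T" and u: "u > 0" "u \<le> v"
  shows "metric_massiveness T v \<le> metric_massiveness T u"
proof -
  obtain \<B> where \<B>: "finite \<B>" "card \<B> = metric_massiveness T u"
      "\<forall>B\<in>\<B>. \<exists>c\<in>T. \<exists>r. 0 \<le> r \<and> r \<le> u \<and> B = cball c r \<inter> T" "T \<subseteq> \<Union>\<B>"
    using massiveness_cover[OF T u(1)] by blast
  have "\<exists>c\<in>T. \<exists>r. 0 \<le> r \<and> r \<le> v \<and> B = cball c r \<inter> T" if B: "B \<in> \<B>" for B
  proof -
    obtain c r where "c \<in> T" "0 \<le> r" "r \<le> u" "B = cball c r \<inter> T" using B \<B>(3) by blast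
    with order_trans[OF \<open>r \<le> u\<close> u(2)] show ?thesis by blast
  qed
  then show ?thesis
    unfolding metric_massiveness_def[of T v] \<B>(2)[symmetric] using \<B>(1,4)
    by (intro Least_le exI[of _ \<B>]) simp
qed

text \<open>
  By the intermediate value theorem every level in \<open>(0, \<sigma> d]\<close> is attained, and \<open>\<sigma> 0 = 0\<close> keeps the
  inverse away from the radius \<open>0\<close>, at which an infinite space has no finite cover.
\<close>

lemma scale_inverse:
  fixes \<sigma> :: "real \<Rightarrow> real"
  assumes d: "0 \<le> d" and cont: "continuous_on {0..d} \<sigma>" and \<sigma>0: "\<sigma> 0 = 0"
    and u: "0 < u" "u \<le> \<sigma> d"
  shows "\<sigma> (inv_into {0..d} \<sigma> u) = u" and "0 < inv_into {0..d} \<sigma> u" and "inv_into {0..d} \<sigma> u \<le> d"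
proof -
  obtain x where "0 \<le> x" "x \<le> d" "\<sigma> x = u"
    using IVT'[of \<sigma> 0 u d] assms by auto
  then have im: "u \<in> \<sigma> ` {0..d}" by auto
  show eq: "\<sigma> (inv_into {0..d} \<sigma> u) = u" using im by (rule f_inv_into_f)
  have mem: "inv_into {0..d} \<sigma> u \<in> {0..d}" using im by (rule inv_into_into)
  then show "inv_into {0..d} \<sigma> u \<le> d" by simp
  have "inv_into {0..d} \<sigma> u \<noteq> 0" using eq u(1) \<sigma>0 by (metis less_irrefl)
  with mem show "0 < inv_into {0..d} \<sigma> u" by simp
qed

lemma scale_inverse_mono:
  fixes \<sigma> :: "real \<Rightarrow> real"
  assumes d: "0 \<le> d" and cont: "continuous_on {0..d} \<sigma>" and \<sigma>0: "\<sigma> 0 = 0"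
    and mono: "strict_mono_on {0..d} \<sigma>"
    and u: "0 < u" "u \<le> v" "v \<le> \<sigma> d"
  shows "inv_into {0..d} \<sigma> u \<le> inv_into {0..d} \<sigma> v"
proof (rule ccontr)
  note U = scale_inverse[OF d cont \<sigma>0 u(1) order_trans[OF u(2,3)]]
  note V = scale_inverse[OF d cont \<sigma>0 less_le_trans[OF u(1,2)] u(3)]
  assume "\<not> inv_into {0..d} \<sigma> u \<le> inv_into {0..d} \<sigma> v"
  then have "\<sigma> (inv_into {0..d} \<sigma> v) < \<sigma> (inv_into {0..d} \<sigma> u)"
    using U V by (intro strict_mono_onD[OF mono]) auto
  then show False using U V u by simp
qed

text \<open>
  The interval \<open>(c p\<^sup>k\<^sup>+\<^sup>1, c p\<^sup>k]\<close> has length \<open>(1 - p) c p\<^sup>k\<close> and \<open>f\<close> is smallest at its right end, so the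
  \<open>k\<close>-th term is at most the integral over that interval; the intervals are disjoint.
\<close>

lemma geometric_sum_le_integral:
  fixes f :: "real \<Rightarrow> real"
  assumes int: "set_integrable lborel {0<..c} f"
    and anti: "antimono_on {0<..c} f" and nn: "\<And>x. x \<in> {0<..c} \<Longrightarrow> 0 \<le> f x"
    and c: "0 < c" and p: "0 < p" "p < 1"
  shows "(1 - p) * (\<Sum>k<n. f (c * p ^ k) * (c * p ^ k)) \<le> (LINT u:{0<..c}|lborel. f u)"
proof -
  have split: "(LINT u:{0<..b}|lborel. f u) = (LINT u:{0<..a}|lborel. f u) + (LINT u:{a<..b}|lborel. f u)"
    if "0 \<le> a" "a \<le> b" "b \<le> c" for a b
  proof -
    have eq: "{0<..b} = {0<..a} \<union> {a<..b}" using that by auto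
    show ?thesis
      unfolding eq
    proof (rule set_integral_Un)
      show "set_integrable lborel {0<..a} f" "set_integrable lborel {a<..b} f"
        using that by (auto intro!: set_integrable_subset[OF int])
    qed auto
  qed
  have const_int: "set_integrable lborel {a<..b} (\<lambda>_. y)" if "a \<le> b" for a b y :: real
    using that by (simp add: set_integrable_def integrable_indicator_iff)
  have "(1 - p) * (\<Sum>k<n. f (c * p ^ k) * (c * p ^ k)) + (LINT u:{0<..c * p ^ n}|lborel. f u)
     \<le> (LINT u:{0<..c}|lborel. f u)"
  proof (induction n)
    case 0
    then show ?case by simp
  next
    case (Suc n)
    let ?a = "c * p ^ Suc n" and ?b = "c * p ^ n"
    have ab: "0 < ?a" "?a \<le> ?b" "?b \<le> c"
      using c p by (auto simp: mult_le_one power_le_one mult_left_le_one_le)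
    have "(1 - p) * (f ?b * ?b) = (LINT u:{?a<..?b}|lborel. f ?b)"
      using ab by (simp add: set_integral_const algebra_simps)
    also have "\<dots> \<le> (LINT u:{?a<..?b}|lborel. f u)"
    proof (rule set_integral_mono)
      show "set_integrable lborel {?a<..?b} f" using ab by (intro set_integrable_subset[OF int]) auto
      show "f ?b \<le> f u" if "u \<in> {?a<..?b}" for u
        using that ab(3) less_trans[OF ab(1)] less_le_trans[OF ab(1,2)]
        by (intro monotone_onD[OF anti]) (simp_all only: greaterThanAtMost_iff, metis order_trans)
      show "set_integrable lborel {?a<..?b} (\<lambda>_. f ?b)" by (rule const_int[OF ab(2)])
    qed
    finally show ?case 
      using Suc split[OF less_imp_le[OF ab(1)] ab(2,3)] by (simp add: distrib_left)
  qed
  moreover have "0 \<le> (LINT u:{0<..c * p ^ n}|lborel. f u)"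
  proof -
    have "c * p ^ n \<le> c" using c p by (intro mult_left_le power_le_one) auto
    then show ?thesis
      unfolding set_lebesgue_integral_def using nn
      by (intro Bochner_Integration.integral_nonneg) (auto simp: indicator_def)
  qed
  ultimately show ?thesis by linarith
qed

section \<open>Chaining\<close>

text \<open>
  One link of the chain: move each point of \<open>A\<close> to a neighbour in \<open>B\<close>. The maximum over \<open>A\<close> is at most
  the maximum over \<open>B\<close> plus the maximum of \<open>card A\<close> increments, each of norm at most \<open>c\<close>.
\<close>

lemma moment_bounded_Max_step:
  fixes X :: "'a \<Rightarrow> 'w \<Rightarrow> real"
  assumes P: "prob_space M" and F: "is_moment_space F" and \<kappa>: "majorizing_characteristic M F \<kappa>"
    and A: "finite A" "A \<noteq> {}" "card A \<le> n" and B: "finite B"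
    and X: "\<And>t. t \<in> A \<union> B \<Longrightarrow> X t \<in> moment_carrier M F"
    and near: "\<And>a. a \<in> A \<Longrightarrow> \<exists>b\<in>B. moment_norm M F (\<lambda>\<omega>. X a \<omega> - X b \<omega>) \<le> c"
    and C: "C \<ge> 0" and c: "c \<ge> 0" and bnd: "moment_bounded M F C (\<lambda>\<omega>. MAX b\<in>B. \<bar>X b \<omega>\<bar>)"
  shows "moment_bounded M F (C + \<kappa> n * c) (\<lambda>\<omega>. MAX a\<in>A. \<bar>X a \<omega>\<bar>)"
proof -
  obtain \<pi> where \<pi>: "\<pi> a \<in> B" "moment_norm M F (\<lambda>\<omega>. X a \<omega> - X (\<pi> a) \<omega>) \<le> c" if "a \<in> A" for a
    using near by metis
  let ?D = "\<lambda>\<omega>. MAX a\<in>A. \<bar>X a \<omega> - X (\<pi> a) \<omega>\<bar>"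
  have "card A \<ge> 1" using A by (simp add: Suc_le_eq card_gt_0_iff)
  then have "\<kappa> n \<ge> 0"
    using majorizing_characteristic_ge_1[OF P F \<kappa>, of n] A(3) by simp
  moreover have D: "moment_bounded M F (\<kappa> n * c) ?D"
    using X \<pi> by (intro moment_bounded_Max[OF P F \<kappa> A] moment_carrier_diff[OF F]) simp_all
  ultimately have sum: "moment_bounded M F (C + \<kappa> n * c) (\<lambda>\<omega>. (MAX b\<in>B. \<bar>X b \<omega>\<bar>) + ?D \<omega>)"
    using c by (intro moment_bounded_add[OF F C _ bnd D]) simp
  have "(\<lambda>\<omega>. MAX a\<in>A. \<bar>X a \<omega>\<bar>) \<in> borel_measurable M"
    using X by (intro moment_carrier_measurable[OF moment_carrier_Max[OF F A(1,2)]]) simp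
  then show ?thesis
  proof (rule moment_bounded_dominated[OF F sum])
    fix \<omega>
    have pt: "\<bar>X a \<omega>\<bar> \<le> (MAX b\<in>B. \<bar>X b \<omega>\<bar>) + ?D \<omega>" if a: "a \<in> A" for a
    proof -
      have "\<bar>X (\<pi> a) \<omega>\<bar> \<le> (MAX b\<in>B. \<bar>X b \<omega>\<bar>)" using B \<pi>(1)[OF a] by simp
      moreover have "\<bar>X a \<omega> - X (\<pi> a) \<omega>\<bar> \<le> ?D \<omega>" using A(1) a by simp
      ultimately show ?thesis by linarith
    qed
    obtain a where a: "a \<in> A" using A(2) by blast
    have "0 \<le> (MAX a\<in>A. \<bar>X a \<omega>\<bar>)"
      using A(1) a by (intro order_trans[OF abs_ge_zero[of "X a \<omega>"] Max_ge]) auto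
    moreover have "(MAX a\<in>A. \<bar>X a \<omega>\<bar>) \<le> (MAX b\<in>B. \<bar>X b \<omega>\<bar>) + ?D \<omega>"
      using A(1,2) pt by (intro Max.boundedI) auto
    ultimately show "\<bar>MAX a\<in>A. \<bar>X a \<omega>\<bar>\<bar> \<le> \<bar>(MAX b\<in>B. \<bar>X b \<omega>\<bar>) + ?D \<omega>\<bar>" by linarith
  qed
qed

text \<open>
  The chaining bound over a finite set of times. The nets \<open>V k\<close> have increments at scale
  \<open>\<epsilon> k = \<gamma> p\<^sup>k\<close>, starting from the single point \<open>t0\<close>, which is within the diameter of everything.
  Passing from \<open>V k\<close> to \<open>V (Suc k)\<close> costs \<open>f (\<epsilon> (Suc k)) * \<epsilon> k\<close>: the number of points is governed by
  the finer level and the size of the increments by the coarser one. This mismatch of one level is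
  the factor \<open>1 / p\<close> in the bound; the factor \<open>1 / (1 - p)\<close> and the upper limit \<open>\<gamma> p\<close> of the integral
  come from comparing the geometric sum with the integral. The set \<open>A\<close> is attached to \<open>V n\<close> by one
  further link, whose cost \<open>\<kappa>\<^sub>0 (card A) * \<epsilon> n\<close> vanishes as \<open>n\<close> grows because \<open>A\<close> is fixed.
\<close>

lemma moment_norm_finite_Max_le:
  fixes M :: "'w measure" and T :: "'a::metric_space set" and X :: "'a \<Rightarrow> 'w \<Rightarrow> real"
    and \<kappa> \<sigma> :: "real \<Rightarrow> real"
  assumes P: "prob_space M" and T: "compact T" and t0: "t0 \<in> T" and F: "is_moment_space F"
    and X: "\<And>t. t \<in> T \<Longrightarrow> X t \<in> moment_carrier M F"
    and maj: "majorizing_characteristic M F \<kappa>\<^sub>0"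
    and \<kappa>_mono: "mono_on {1..} \<kappa>" and \<kappa>_eq: "\<And>n. n \<ge> 1 \<Longrightarrow> \<kappa> (real n) = \<kappa>\<^sub>0 n"
    and cont: "continuous_on {0..diameter T} \<sigma>" and mono: "strict_mono_on {0..diameter T} \<sigma>"
    and \<sigma>0: "\<sigma> 0 = 0"
    and incr: "\<And>h t s. \<lbrakk>h \<in> {0..diameter T}; t \<in> T; s \<in> T; dist t s \<le> h\<rbrakk>
           \<Longrightarrow> moment_norm M F (\<lambda>\<omega>. X t \<omega> - X s \<omega>) \<le> \<sigma> h"
    and int: "\<And>z. z > 0 \<Longrightarrow>
           set_integrable lborel {0<..z} (\<lambda>u. \<kappa> (real (massiveness_inv T \<sigma> u)))"
    and A: "finite A" "A \<noteq> {}" "A \<subseteq> T" and p: "0 < p" "p < 1"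
  shows "moment_norm M F (\<lambda>\<omega>. MAX a\<in>A. \<bar>X a \<omega>\<bar>) \<le> moment_norm M F (X t0)
           + 1 / (p * (1 - p)) *
             (LINT u:{0<..\<sigma> (diameter T) * p}|lborel. \<kappa> (real (massiveness_inv T \<sigma> u)))"
proof -
  define d where "d = diameter T"
  define \<gamma> where "\<gamma> = \<sigma> d"
  define f where "f = (\<lambda>u. \<kappa> (real (massiveness_inv T \<sigma> u)))"
  note cont = cont[folded d_def] and mono = mono[folded d_def] and incr = incr[folded d_def]
    and int = int[folded f_def]
  have bT: "bounded T" using T by (rule compact_imp_bounded)
  have d: "0 \<le> d" unfolding d_def using bT by (rule diameter_ge_0)
  have dist_le_d: "dist t s \<le> d" if "t \<in> T" "s \<in> T" for t s
    unfolding d_def using bT that by (rule diameter_bounded_bound)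
  have norm0: "0 \<le> moment_norm M F (X t0)" by (rule moment_norm_nonneg[OF F X[OF t0]])
  have start: "moment_bounded M F (moment_norm M F (X t0)) (\<lambda>\<omega>. MAX b\<in>{t0}. \<bar>X b \<omega>\<bar>)"
    using moment_bounded_abs[OF moment_bounded_moment_norm[OF F X[OF t0] order_refl]] by simp
  show ?thesis
  proof (cases "d = 0")
    \<comment> \<open>Here T is a single point: the scale is degenerate and the integral vanishes.\<close>
    case True
    have "a = t0" if "a \<in> A" for a
      using dist_le_d[OF _ t0, of a] that A(3) True by auto
    then have "A = {t0}" using A(2) by blast
    then show ?thesis
      using moment_boundedD(2)[OF F norm0 start] True by (simp add: d_def \<sigma>0 set_lebesgue_integral_def)
  next
    case False
    then have \<gamma>: "0 < \<gamma>"
      using strict_mono_onD[OF mono, of 0 d] d \<sigma>0 by (simp add: \<gamma>_def)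
    define r where "r = inv_into {0..d} \<sigma>"
    have r: "\<sigma> (r u) = u" "0 < r u" "r u \<le> d" if "0 < u" "u \<le> \<gamma>" for u
      unfolding r_def using scale_inverse[OF d cont \<sigma>0 that[unfolded \<gamma>_def]] by auto
    have r_mono: "r u \<le> r v" if "0 < u" "u \<le> v" "v \<le> \<gamma>" for u v
      unfolding r_def using scale_inverse_mono[OF d cont \<sigma>0 mono that[unfolded \<gamma>_def]] .
    have N1: "1 \<le> metric_massiveness T (r u)" if "0 < u" "u \<le> \<gamma>" for u
      using massiveness_ge_1[OF T _ r(2)[OF that]] t0 by blast
    have f_eq: "f u = \<kappa> (real (metric_massiveness T (r u)))" if "u \<le> \<gamma>" for u
      using that by (simp add: f_def massiveness_inv_def r_def \<gamma>_def d_def)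
    have f_\<kappa>0: "f u = \<kappa>\<^sub>0 (metric_massiveness T (r u))" if "0 < u" "u \<le> \<gamma>" for u
      using f_eq[OF that(2)] \<kappa>_eq[OF N1[OF that]] by simp
    have f_ge_1: "1 \<le> f u" if "0 < u" "u \<le> \<gamma>" for u
      using majorizing_characteristic_ge_1[OF P F maj N1[OF that]] f_\<kappa>0[OF that] by simp
    have f_anti: "antimono_on {0<..\<gamma>} f"
    proof (rule monotone_onI)
      fix u v assume uv: "u \<in> {0<..\<gamma>}" "v \<in> {0<..\<gamma>}" "u \<le> v"
      have "metric_massiveness T (r v) \<le> metric_massiveness T (r u)"
        using uv by (intro massiveness_antimono[OF T r(2) r_mono]) auto
      then show "f v \<le> f u"
        using uv f_eq[of u] f_eq[of v] N1[of v] by (auto intro!: mono_onD[OF \<kappa>_mono])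
    qed
    define \<epsilon> where "\<epsilon> = (\<lambda>k. \<gamma> * p ^ k)"
    have \<epsilon>: "0 < \<epsilon> k" "\<epsilon> k \<le> \<gamma>" for k
      using \<gamma> p by (auto simp: \<epsilon>_def power_le_one mult_left_le)
    have "\<exists>V\<subseteq>T. finite V \<and> V \<noteq> {} \<and> card V \<le> metric_massiveness T (r (\<epsilon> k)) \<and>
        (\<forall>t\<in>T. \<exists>v\<in>V. dist t v \<le> r (\<epsilon> k))" for k
      by (rule massiveness_net[OF T _ r(2)[OF \<epsilon>]]) (use t0 in blast)
    then obtain W where W: "W k \<subseteq> T" "finite (W k)" "W k \<noteq> {}"
        "card (W k) \<le> metric_massiveness T (r (\<epsilon> k))" "\<forall>t\<in>T. \<exists>v\<in>W k. dist t v \<le> r (\<epsilon> k)" for k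
      by metis
    define V where "V = (\<lambda>k. if k = 0 then {t0} else W k)"
    \<comment> \<open>The coarsest radius is the whole diameter, which is why one point suffices at level 0.\<close>
    have r0: "r (\<epsilon> 0) = d"
      using r(3)[OF \<epsilon>, of 0] r(1,2)[OF \<epsilon>, of 0] strict_mono_onD[OF mono, of "r (\<epsilon> 0)" d] d
      by (force simp: \<epsilon>_def \<gamma>_def)
    have V: "V k \<subseteq> T" "finite (V k)" "V k \<noteq> {}" for k
      using W t0 by (auto simp: V_def)
    have card_V: "card (V (Suc k)) \<le> metric_massiveness T (r (\<epsilon> (Suc k)))" for k
      using W(4)[of "Suc k"] by (simp add: V_def)
    have near: "\<exists>v\<in>V k. moment_norm M F (\<lambda>\<omega>. X t \<omega> - X v \<omega>) \<le> \<epsilon> k" if t: "t \<in> T" for k t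
    proof -
      obtain v where v: "v \<in> V k" "dist t v \<le> r (\<epsilon> k)"
        using W(5)[of k] t dist_le_d[OF t t0] r0 by (cases "k = 0") (auto simp: V_def)
      have "moment_norm M F (\<lambda>\<omega>. X t \<omega> - X v \<omega>) \<le> \<sigma> (r (\<epsilon> k))"
        using v V(1) t r(2,3)[OF \<epsilon>] by (intro incr) (auto intro: less_imp_le)
      with v(1) show ?thesis using r(1)[OF \<epsilon>] by auto
    qed
    define c where "c = (\<lambda>n. moment_norm M F (X t0) + (\<Sum>k<n. f (\<epsilon> (Suc k)) * \<epsilon> k))"
    have c0: "0 \<le> c n" for n
      unfolding c_def using norm0 f_ge_1[OF \<epsilon>] \<epsilon>(1)
      by (intro add_nonneg_nonneg sum_nonneg mult_nonneg_nonneg) (auto intro: less_imp_le order_trans[OF zero_le_one])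
    have chain: "moment_bounded M F (c n) (\<lambda>\<omega>. MAX b\<in>V n. \<bar>X b \<omega>\<bar>)" for n
    proof (induction n)
      case 0
      show ?case using start by (simp add: c_def V_def)
    next
      case (Suc n)
      have "moment_bounded M F (c n + \<kappa>\<^sub>0 (metric_massiveness T (r (\<epsilon> (Suc n)))) * \<epsilon> n)
          (\<lambda>\<omega>. MAX b\<in>V (Suc n). \<bar>X b \<omega>\<bar>)"
      proof (rule moment_bounded_Max_step[OF P F maj V(2,3) card_V V(2) _ _ c0 _ Suc])
        show "X t \<in> moment_carrier M F" if "t \<in> V (Suc n) \<union> V n" for t
          using that V(1) X by blast
        show "\<exists>b\<in>V n. moment_norm M F (\<lambda>\<omega>. X a \<omega> - X b \<omega>) \<le> \<epsilon> n" if "a \<in> V (Suc n)" for a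
          using that V(1) by (intro near) blast
        show "0 \<le> \<epsilon> n" using \<epsilon>(1)[of n] by simp
      qed
      then show ?case by (simp add: c_def f_\<kappa>0[OF \<epsilon>] add.assoc)
    qed
    define I where "I = (LINT u:{0<..\<gamma> * p}|lborel. f u)"
    have c_le: "c n \<le> moment_norm M F (X t0) + 1 / (p * (1 - p)) * I" for n
    proof -
      \<comment> \<open>The sum starts at level 1, hence the comparison is made from the endpoint \<open>\<gamma> * p\<close>.\<close>
      have "(1 - p) * (\<Sum>k<n. f (\<gamma> * p * p ^ k) * (\<gamma> * p * p ^ k)) \<le> I"
        unfolding I_def
      proof (rule geometric_sum_le_integral)
        have "\<gamma> * p \<le> \<gamma>" using \<gamma> p by (intro mult_left_le) auto
        then have sub: "{0<..\<gamma> * p} \<subseteq> {0<..\<gamma>}" by auto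
        show "set_integrable lborel {0<..\<gamma> * p} f" using \<gamma> p by (intro int) simp
        show "antimono_on {0<..\<gamma> * p} f" using f_anti sub by (rule monotone_on_subset)
        show "0 \<le> f u" if "u \<in> {0<..\<gamma> * p}" for u
          using f_ge_1[of u] subsetD[OF sub that] by simp
      qed (use \<gamma> p in auto)
      also have "(1 - p) * (\<Sum>k<n. f (\<gamma> * p * p ^ k) * (\<gamma> * p * p ^ k))
          = p * (1 - p) * (\<Sum>k<n. f (\<epsilon> (Suc k)) * \<epsilon> k)"
        by (simp add: \<epsilon>_def sum_distrib_left algebra_simps)
      finally show ?thesis
        using p by (simp add: c_def field_simps)
    qed
    have step: "moment_norm M F (\<lambda>\<omega>. MAX a\<in>A. \<bar>X a \<omega>\<bar>)
        \<le> moment_norm M F (X t0) + 1 / (p * (1 - p)) * I + \<kappa>\<^sub>0 (card A) * \<epsilon> n" for n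
    proof -
      have "card A \<ge> 1" using A by (simp add: Suc_le_eq card_gt_0_iff)
      then have "1 \<le> \<kappa>\<^sub>0 (card A)" by (rule majorizing_characteristic_ge_1[OF P F maj])
      then have nn: "0 \<le> c n + \<kappa>\<^sub>0 (card A) * \<epsilon> n" using c0[of n] \<epsilon>(1)[of n] by simp
      have "moment_bounded M F (c n + \<kappa>\<^sub>0 (card A) * \<epsilon> n) (\<lambda>\<omega>. MAX a\<in>A. \<bar>X a \<omega>\<bar>)"
      proof (rule moment_bounded_Max_step[OF P F maj A(1,2) order_refl V(2) _ _ c0 _ chain])
        show "X t \<in> moment_carrier M F" if "t \<in> A \<union> V n" for t
          using that V(1) A(3) X by blast
        show "\<exists>b\<in>V n. moment_norm M F (\<lambda>\<omega>. X a \<omega> - X b \<omega>) \<le> \<epsilon> n" if "a \<in> A" for a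
          using that A(3) by (intro near) blast
        show "0 \<le> \<epsilon> n" using \<epsilon>(1)[of n] by simp
      qed
      from moment_boundedD(2)[OF F nn this] c_le[of n] show ?thesis by linarith
    qed
    have "(\<lambda>n. moment_norm M F (X t0) + 1 / (p * (1 - p)) * I + \<kappa>\<^sub>0 (card A) * (\<gamma> * p ^ n))
        \<longlonglongrightarrow> moment_norm M F (X t0) + 1 / (p * (1 - p)) * I + \<kappa>\<^sub>0 (card A) * (\<gamma> * 0)"
      using p by (intro tendsto_intros LIMSEQ_realpow_zero) auto
    then have "moment_norm M F (\<lambda>\<omega>. MAX a\<in>A. \<bar>X a \<omega>\<bar>)
        \<le> moment_norm M F (X t0) + 1 / (p * (1 - p)) * I + \<kappa>\<^sub>0 (card A) * (\<gamma> * 0)"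
      using step by (intro LIMSEQ_le_const) (auto simp: \<epsilon>_def)
    then show ?thesis by (simp add: I_def \<gamma>_def f_def d_def)
  qed
qed

section \<open>The supremum of the process\<close>

text \<open>
  Separability is applied to the closed set of values whose modulus is at most the supremum over the
  separant; this set is the whole line where that supremum is infinite.
\<close>

lemma SUP_abs_eq_on_separant:
  assumes D: "D \<subseteq> T"
    and sep: "\<And>C. closed C \<Longrightarrow> \<forall>t\<in>D. X t \<omega> \<in> C \<Longrightarrow> \<forall>t\<in>T. X t \<omega> \<in> C"
  shows "(SUP t\<in>T. ereal \<bar>X t \<omega>\<bar>) = (SUP t\<in>D. ereal \<bar>X t \<omega>\<bar>)"
proof (rule antisym)
  show "(SUP t\<in>D. ereal \<bar>X t \<omega>\<bar>) \<le> (SUP t\<in>T. ereal \<bar>X t \<omega>\<bar>)"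
    using D by (intro SUP_subset_mono) auto
  let ?S = "SUP t\<in>D. ereal \<bar>X t \<omega>\<bar>"
  have closed: "closed {x. ereal \<bar>x\<bar> \<le> ?S}"
    by (intro closed_Collect_le continuous_intros)
  have "\<forall>t\<in>D. X t \<omega> \<in> {x. ereal \<bar>x\<bar> \<le> ?S}" by (auto intro: SUP_upper)
  from sep[OF closed this] show "(SUP t\<in>T. ereal \<bar>X t \<omega>\<bar>) \<le> ?S"
    by (intro SUP_least) auto
qed

text \<open>
  The representative \<open>Y\<close> is the supremum over the separant, taken along finite initial segments
  of an enumeration. It is fixed before \<open>p\<close>, so that one random variable satisfies the bounds for all
  \<open>p\<close> simultaneously.
\<close>

theorem theorem3p1:
  fixes M :: "'w measure"
    and T :: "'a::metric_space set"
    and X :: "'a \<Rightarrow> 'w \<Rightarrow> real"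
    and F :: moment_space
    and \<kappa>\<^sub>0 :: "nat \<Rightarrow> real"
    and \<kappa> \<sigma> :: "real \<Rightarrow> real"
    and \<gamma> :: real
  assumes "prob_space M"
    and "compact T" and "T \<noteq> {}"
    and "is_moment_space F"
    and "separable_process M T X"
    and "\<And>t. t \<in> T \<Longrightarrow> X t \<in> moment_carrier M F"
    and "majorizing_characteristic M F \<kappa>\<^sub>0"
    and "mono_on {1..} \<kappa>"
    and "\<And>n. n \<ge> 1 \<Longrightarrow> \<kappa> (real n) = \<kappa>\<^sub>0 n"
    and "continuous_on {0..diameter T} \<sigma>"
    and "strict_mono_on {0..diameter T} \<sigma>"
    and "\<sigma> 0 = 0"
    and "\<And>h t s. \<lbrakk>h \<in> {0..diameter T}; t \<in> T; s \<in> T; dist t s \<le> h\<rbrakk>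
           \<Longrightarrow> moment_norm M F (\<lambda>\<omega>. X t \<omega> - X s \<omega>) \<le> \<sigma> h"
    and "\<And>z. z > 0 \<Longrightarrow>
           set_integrable lborel {0<..z} (\<lambda>u. \<kappa> (real (massiveness_inv T \<sigma> u)))"
    and "\<gamma> = \<sigma> (diameter T)"
  shows "\<exists>Y \<in> moment_carrier M F.
           (AE \<omega> in M. (SUP t\<in>T. ereal \<bar>X t \<omega>\<bar>) = ereal (Y \<omega>)) \<and>
           (\<forall>p. 0 < p \<and> p < 1 \<longrightarrow>
              moment_norm M F Y
                \<le> (INF t\<in>T. moment_norm M F (X t))
                   + 1 / (p * (1 - p)) *
                     (LINT u:{0<..\<gamma> * p}|lborel. \<kappa> (real (massiveness_inv T \<sigma> u))))"
proof -
  note F = assms(4)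
  obtain D N where DN: "countable D" "D \<subseteq> T" "T \<subseteq> closure D" "N \<in> null_sets M"
    and sep: "\<And>G C \<omega>. openin (top_of_set T) G \<Longrightarrow> closed C \<Longrightarrow> \<omega> \<in> space M - N \<Longrightarrow>
           (\<forall>t\<in>G \<inter> D. X t \<omega> \<in> C) \<longleftrightarrow> (\<forall>t\<in>G. X t \<omega> \<in> C)"
    using assms(5) unfolding separable_process_def by meson
  have D0: "D \<noteq> {}" using DN(3) assms(3) by auto
  \<comment> \<open>The enumeration may repeat points, which also covers a finite separant.\<close>
  define e where "e = from_nat_into D"
  have e: "range e = D" unfolding e_def using DN(1) D0 by simp
  define \<xi> where "\<xi> = (\<lambda>n \<omega>. MAX a\<in>e ` {..n}. \<bar>X a \<omega>\<bar>)"
  define Y where "Y = (\<lambda>\<omega>. real_of_ereal (SUP n. ereal (\<xi> n \<omega>)))"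
  define B where "B = (\<lambda>p. (INF t\<in>T. moment_norm M F (X t))
                   + 1 / (p * (1 - p)) *
                     (LINT u:{0<..\<gamma> * p}|lborel. \<kappa> (real (massiveness_inv T \<sigma> u))))"
  have sub: "e ` {..n} \<subseteq> T" for n using e DN(2) by auto
  have \<xi>_carrier: "\<xi> n \<in> moment_carrier M F" for n
    unfolding \<xi>_def using sub[of n] assms(6) by (intro moment_carrier_Max[OF F]) auto
  have \<xi>_le: "moment_norm M F (\<xi> n) \<le> B p" if p: "0 < p" "p < 1" for p n
  proof -
    let ?I = "1 / (p * (1 - p)) * (LINT u:{0<..\<gamma> * p}|lborel. \<kappa> (real (massiveness_inv T \<sigma> u)))"
    \<comment> \<open>The starting point of the chain is arbitrary, which yields the infimum over T.\<close>
    have "moment_norm M F (\<xi> n) - ?I \<le> moment_norm M F (X t)" if "t \<in> T" for t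
    proof -
      have "moment_norm M F (\<xi> n) \<le> moment_norm M F (X t) + ?I"
        unfolding \<xi>_def assms(15)
        by (rule moment_norm_finite_Max_le[OF assms(1,2) that F assms(6-14)]) (use sub[of n] p in auto)
      then show ?thesis by linarith
    qed
    then have "moment_norm M F (\<xi> n) - ?I \<le> (INF t\<in>T. moment_norm M F (X t))"
      using assms(3) by (intro cINF_greatest) auto
    then show "moment_norm M F (\<xi> n) \<le> B p" unfolding B_def by linarith
  qed
  have \<xi>_bounded: "moment_bounded M F (B p) (\<xi> n)" if "0 < p" "p < 1" for p n
    by (rule moment_bounded_moment_norm[OF F \<xi>_carrier \<xi>_le[OF that]])
  have \<xi>_inc: "incseq (\<lambda>n. \<xi> n \<omega>)" for \<omega>
    unfolding \<xi>_def by (intro monoI Max_mono image_mono) auto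
  have \<xi>_upper: "\<bar>X (e k) \<omega>\<bar> \<le> \<xi> k \<omega>" for k \<omega>
    unfolding \<xi>_def by (intro Max_ge) auto
  have \<xi>_nonneg: "0 \<le> \<xi> n \<omega>" for n \<omega>
    using \<xi>_upper[of n \<omega>] by linarith
  have SUP_\<xi>: "(SUP n. ereal (\<xi> n \<omega>)) = (SUP t\<in>D. ereal \<bar>X t \<omega>\<bar>)" for \<omega>
  proof (rule antisym)
    show "(SUP n. ereal (\<xi> n \<omega>)) \<le> (SUP t\<in>D. ereal \<bar>X t \<omega>\<bar>)"
    proof (rule SUP_least)
      fix n
      have "\<xi> n \<omega> \<in> (\<lambda>a. \<bar>X a \<omega>\<bar>) ` e ` {..n}" unfolding \<xi>_def by (rule Max_in) auto
      then obtain a where "a \<in> D" "\<xi> n \<omega> = \<bar>X a \<omega>\<bar>" using e by auto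
      then show "ereal (\<xi> n \<omega>) \<le> (SUP t\<in>D. ereal \<bar>X t \<omega>\<bar>)" by (auto intro: SUP_upper)
    qed
    show "(SUP t\<in>D. ereal \<bar>X t \<omega>\<bar>) \<le> (SUP n. ereal (\<xi> n \<omega>))"
    proof (rule SUP_least)
      fix t assume "t \<in> D"
      then obtain k where "t = e k" using e by auto
      then have "ereal \<bar>X t \<omega>\<bar> \<le> ereal (\<xi> k \<omega>)" using \<xi>_upper by simp
      also have "\<dots> \<le> (SUP n. ereal (\<xi> n \<omega>))" by (rule SUP_upper) simp
      finally show "ereal \<bar>X t \<omega>\<bar> \<le> (SUP n. ereal (\<xi> n \<omega>))" .
    qed
  qed
  have Y_bounded: "moment_bounded M F (B p) Y" if "0 < p" "p < 1" for p
    unfolding Y_def by (rule moment_bounded_SUP(1)[OF F \<xi>_bounded[OF that] \<xi>_inc \<xi>_nonneg])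
  have B0: "0 \<le> B p" if "0 < p" "p < 1" for p
    by (rule order_trans[OF moment_norm_nonneg[OF F \<xi>_carrier] \<xi>_le[OF that]])
  have "AE \<omega> in M. (SUP n. ereal (\<xi> n \<omega>)) = ereal (Y \<omega>)"
    unfolding Y_def
    by (rule moment_bounded_SUP(2)[OF F \<xi>_bounded[of "1/2"] \<xi>_inc \<xi>_nonneg]) simp_all
  moreover have "AE \<omega> in M. \<omega> \<in> space M - N"
    using AE_not_in[OF DN(4)] AE_space by eventually_elim simp
  ultimately have "AE \<omega> in M. (SUP t\<in>T. ereal \<bar>X t \<omega>\<bar>) = ereal (Y \<omega>)"
  proof eventually_elim
    case (elim \<omega>)
    have "\<forall>t\<in>T. X t \<omega> \<in> C" if "closed C" "\<forall>t\<in>D. X t \<omega> \<in> C" for C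
      using sep[OF openin_subtopology_self that(1) elim(2)] that(2) by blast
    from SUP_abs_eq_on_separant[of D T X \<omega>, OF DN(2) this] elim(1) SUP_\<xi> show ?case by simp
  qed
  moreover have "Y \<in> moment_carrier M F"
    by (rule moment_boundedD(1)[OF F B0[of "1/2"] Y_bounded[of "1/2"]]) simp_all
  moreover have "moment_norm M F Y \<le> B p" if "0 < p" "p < 1" for p
    by (rule moment_boundedD(2)[OF F B0[OF that] Y_bounded[OF that]])
  ultimately show ?thesis unfolding B_def by blast
qed

end
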